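(* Let $\xi\in\partial\mathbb B$ and let $f$ be a slice regular function on $\mathbb B\cup\{\xi\}$ such that $f(\mathbb B)\subseteq\mathbb B$, $f(0)=0$ and $f(\xi)=\xi$. Then $|f'(\xi)|>1$ unless $f(q)=q$ for all $q\in\mathbb B$.
   Context: $\mathbb H$ is the algebra of quaternions, $\mathbb B=\{q\in\mathbb H:|q|<1\}$, $\mathbb S=\{q\in\mathbb H:q^2=-1\}$, and $\mathbb C_I=\mathbb R\oplus I\mathbb R$ for $I\in\mathbb S$. A function $f$ on a domain $\Omega\subseteq\mathbb H$ is slice regular if for every $I\in\mathbb S$ its restriction $f_I$ to $\Omega\cap\mathbb C_I$ has continuous partial derivatives and satisfies $\frac12\left(\frac{\partial}{\partial x}+I\frac{\partial}{\partial y}\right)f_I(x+yI)=0$. The slice derivative is $f'(x+yI)=\frac12\left(\frac{\partial}{\partial x}-I\frac{\partial}{\partial y}\right)f_I(x+yI)$. "Slice regular on $\mathbb B\cup\{\xi\}$" means: slice regular on some domain $\Omega\subseteq\mathbb H$ containing $\mathbb B\cup\{\xi\}$ and such that $\Omega\cap\mathbb C_I$ is a domain of $\mathbb C_I$ for every $I\in\mathbb S$. *)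

theory Defs
  imports "HOL-Analysis.Analysis"
begin

section \<open>The quaternions as a real normed division algebra\<close>

codatatype quat = Quat (qRe: real) (qIm1: real) (qIm2: real) (qIm3: real)

lemma quat_eqI [intro?]:
  "\<lbrakk>qRe x = qRe y; qIm1 x = qIm1 y; qIm2 x = qIm2 y; qIm3 x = qIm3 y\<rbrakk> \<Longrightarrow> x = y"
  by (rule quat.expand) simp

lemma quat_eq_iff:
  "x = y \<longleftrightarrow> qRe x = qRe y \<and> qIm1 x = qIm1 y \<and> qIm2 x = qIm2 y \<and> qIm3 x = qIm3 y"
  by (auto intro: quat.expand)

instantiation quat :: ab_group_add
begin

primcorec zero_quat where
  "qRe 0 = 0" | "qIm1 0 = 0" | "qIm2 0 = 0" | "qIm3 0 = 0"

primcorec plus_quat where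
  "qRe (x + y) = qRe x + qRe y"
| "qIm1 (x + y) = qIm1 x + qIm1 y"
| "qIm2 (x + y) = qIm2 x + qIm2 y"
| "qIm3 (x + y) = qIm3 x + qIm3 y"

primcorec uminus_quat where
  "qRe (- x) = - qRe x"
| "qIm1 (- x) = - qIm1 x"
| "qIm2 (- x) = - qIm2 x"
| "qIm3 (- x) = - qIm3 x"

primcorec minus_quat where
  "qRe (x - y) = qRe x - qRe y"
| "qIm1 (x - y) = qIm1 x - qIm1 y"
| "qIm2 (x - y) = qIm2 x - qIm2 y"
| "qIm3 (x - y) = qIm3 x - qIm3 y"

instance
  by standard (simp_all add: quat_eq_iff)

end

instantiation quat :: ring_1
begin

primcorec one_quat where
  "qRe 1 = 1" | "qIm1 1 = 0" | "qIm2 1 = 0" | "qIm3 1 = 0"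

primcorec times_quat where
  "qRe (x * y) = qRe x * qRe y - qIm1 x * qIm1 y - qIm2 x * qIm2 y - qIm3 x * qIm3 y"
| "qIm1 (x * y) = qRe x * qIm1 y + qIm1 x * qRe y + qIm2 x * qIm3 y - qIm3 x * qIm2 y"
| "qIm2 (x * y) = qRe x * qIm2 y - qIm1 x * qIm3 y + qIm2 x * qRe y + qIm3 x * qIm1 y"
| "qIm3 (x * y) = qRe x * qIm3 y + qIm1 x * qIm2 y - qIm2 x * qIm1 y + qIm3 x * qRe y"

instance
  by standard (simp_all add: quat_eq_iff algebra_simps)

end

instantiation quat :: real_algebra_1
begin

primcorec scaleR_quat where
  "qRe (r *\<^sub>R x) = r * qRe x"
| "qIm1 (r *\<^sub>R x) = r * qIm1 x"
| "qIm2 (r *\<^sub>R x) = r * qIm2 x"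
| "qIm3 (r *\<^sub>R x) = r * qIm3 x"

instance
  by standard (simp_all add: quat_eq_iff algebra_simps)

end

instantiation quat :: real_inner
begin

definition inner_quat :: "quat \<Rightarrow> quat \<Rightarrow> real" where
  "x \<bullet> y = qRe x * qRe y + qIm1 x * qIm1 y + qIm2 x * qIm2 y + qIm3 x * qIm3 y"

definition norm_quat :: "quat \<Rightarrow> real" where
  "norm x = sqrt ((qRe x)\<^sup>2 + (qIm1 x)\<^sup>2 + (qIm2 x)\<^sup>2 + (qIm3 x)\<^sup>2)"

definition sgn_quat :: "quat \<Rightarrow> quat" where
  "sgn (x :: quat) = x /\<^sub>R norm x"

definition dist_quat :: "quat \<Rightarrow> quat \<Rightarrow> real" where
  "dist (x :: quat) y = norm (x - y)"

definition uniformity_quat :: "(quat \<times> quat) filter" where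
  [code del]: "(uniformity :: (quat \<times> quat) filter) =
    (INF e\<in>{0 <..}. principal {(x, y). dist x y < e})"

definition open_quat :: "quat set \<Rightarrow> bool" where
  [code del]: "open (U :: quat set) \<longleftrightarrow>
    (\<forall>x\<in>U. eventually (\<lambda>(x', y). x' = x \<longrightarrow> y \<in> U) uniformity)"

instance
proof
  fix x y z :: quat and r :: real and U :: "quat set"
  show "dist x y = norm (x - y)" by (fact dist_quat_def)
  show "sgn x = x /\<^sub>R norm x" by (fact sgn_quat_def)
  show "(uniformity :: (quat \<times> quat) filter) =
      (INF e\<in>{0 <..}. principal {(x, y). dist x y < e})" by (fact uniformity_quat_def)
  show "open U \<longleftrightarrow> (\<forall>x\<in>U. eventually (\<lambda>(x', y). x' = x \<longrightarrow> y \<in> U) uniformity)"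
    by (fact open_quat_def)
  show "x \<bullet> y = y \<bullet> x" by (simp add: inner_quat_def algebra_simps)
  show "(x + y) \<bullet> z = x \<bullet> z + y \<bullet> z" by (simp add: inner_quat_def algebra_simps)
  show "(r *\<^sub>R x) \<bullet> y = r * (x \<bullet> y)" by (simp add: inner_quat_def algebra_simps)
  show "0 \<le> x \<bullet> x" by (simp add: inner_quat_def)
  show "x \<bullet> x = 0 \<longleftrightarrow> x = 0"
    by (simp add: inner_quat_def quat_eq_iff add_nonneg_eq_0_iff)
  show "norm x = sqrt (x \<bullet> x)"
    by (simp add: norm_quat_def inner_quat_def power2_eq_square)
qed

end

lemma norm_quat_mult: "norm (x * y) = norm x * norm (y :: quat)"
  unfolding norm_quat_def real_sqrt_mult [symmetric]
  by (rule arg_cong [of _ _ sqrt]) (simp add: power2_eq_square algebra_simps)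

instantiation quat :: real_normed_div_algebra
begin

primcorec inverse_quat where
  "qRe (inverse x) = qRe x / (norm x)\<^sup>2"
| "qIm1 (inverse x) = - qIm1 x / (norm x)\<^sup>2"
| "qIm2 (inverse x) = - qIm2 x / (norm x)\<^sup>2"
| "qIm3 (inverse x) = - qIm3 x / (norm x)\<^sup>2"

definition divide_quat :: "quat \<Rightarrow> quat \<Rightarrow> quat" where
  "(x :: quat) div y = x * inverse y"

instance
proof
  fix x y :: quat
  have n: "(norm x)\<^sup>2 = qRe x * qRe x + qIm1 x * qIm1 x + qIm2 x * qIm2 x + qIm3 x * qIm3 x"
    by (simp add: norm_quat_def power2_eq_square)
  show "inverse x * x = 1" if "x \<noteq> 0"
  proof -
    from that have "(norm x)\<^sup>2 \<noteq> 0" by simp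
    then show ?thesis
      by (simp add: quat_eq_iff diff_divide_distrib [symmetric] add_divide_distrib [symmetric] n)
  qed
  show "x * inverse x = 1" if "x \<noteq> 0"
  proof -
    from that have "(norm x)\<^sup>2 \<noteq> 0" by simp
    then show ?thesis
      by (simp add: quat_eq_iff diff_divide_distrib [symmetric] add_divide_distrib [symmetric] n)
  qed
  show "x div y = x * inverse y" by (fact divide_quat_def)
  show "inverse (0 :: quat) = 0" by (simp add: quat_eq_iff)
  show "norm (x * y) = norm x * norm y" by (fact norm_quat_mult)
qed

end

section \<open>Slice regular functions\<close>

definition quat_imag_units :: "quat set" where
  "quat_imag_units = {q. q\<^sup>2 = - 1}"

definition slice_point :: "quat \<Rightarrow> real \<Rightarrow> real \<Rightarrow> quat" where
  "slice_point I x y = of_real x + of_real y * I"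

definition slice_plane :: "quat \<Rightarrow> quat set" where
  "slice_plane I = {slice_point I x y | x y. True}"

definition is_domain_of :: "'a :: topological_space set \<Rightarrow> 'a set \<Rightarrow> bool" where
  "is_domain_of X D \<longleftrightarrow> openin (top_of_set X) D \<and> connected D \<and> D \<noteq> {}"

definition slice_partial_x :: "(quat \<Rightarrow> quat) \<Rightarrow> quat \<Rightarrow> real \<Rightarrow> real \<Rightarrow> quat" where
  "slice_partial_x f I x y = vector_derivative (\<lambda>t. f (slice_point I t y)) (at x)"

definition slice_partial_y :: "(quat \<Rightarrow> quat) \<Rightarrow> quat \<Rightarrow> real \<Rightarrow> real \<Rightarrow> quat" where
  "slice_partial_y f I x y = vector_derivative (\<lambda>t. f (slice_point I x t)) (at y)"

definition slice_C1_on :: "(quat \<Rightarrow> quat) \<Rightarrow> quat \<Rightarrow> quat set \<Rightarrow> bool" where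
  "slice_C1_on f I \<Omega> \<longleftrightarrow>
     (\<forall>x y. slice_point I x y \<in> \<Omega> \<longrightarrow>
        (\<lambda>t. f (slice_point I t y)) differentiable (at x) \<and>
        (\<lambda>t. f (slice_point I x t)) differentiable (at y)) \<and>
     continuous_on {(x, y). slice_point I x y \<in> \<Omega>} (\<lambda>(x, y). slice_partial_x f I x y) \<and>
     continuous_on {(x, y). slice_point I x y \<in> \<Omega>} (\<lambda>(x, y). slice_partial_y f I x y)"

definition slice_regular_on :: "(quat \<Rightarrow> quat) \<Rightarrow> quat set \<Rightarrow> bool" where
  "slice_regular_on f \<Omega> \<longleftrightarrow>
     is_domain_of UNIV \<Omega> \<and>
     (\<forall>I\<in>quat_imag_units. slice_C1_on f I \<Omega> \<and>
        (\<forall>x y. slice_point I x y \<in> \<Omega> \<longrightarrow>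
           (1/2) *\<^sub>R (slice_partial_x f I x y + I * slice_partial_y f I x y) = 0))"

text \<open>
  A quaternion has several representations \<open>x + y I\<close>: two if it is not real, and one for every
  \<open>I\<close> if it is real. The slice derivative is the common value of the defining expression; that
  there is one for slice regular functions is \<open>slice_derivative_eq\<close> below.
\<close>

definition slice_derivative :: "(quat \<Rightarrow> quat) \<Rightarrow> quat \<Rightarrow> quat" where
  "slice_derivative f q =
     (THE d. \<forall>I\<in>quat_imag_units. \<forall>x y. q = slice_point I x y \<longrightarrow>
        d = (1/2) *\<^sub>R (slice_partial_x f I x y - I * slice_partial_y f I x y))"

definition slice_regular_on_ball_and :: "quat \<Rightarrow> (quat \<Rightarrow> quat) \<Rightarrow> bool" where
  "slice_regular_on_ball_and \<xi> f \<longleftrightarrow>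
     (\<exists>\<Omega>. ball 0 1 \<union> {\<xi>} \<subseteq> \<Omega> \<and>
        (\<forall>I\<in>quat_imag_units. is_domain_of (slice_plane I) (\<Omega> \<inter> slice_plane I)) \<and>
        slice_regular_on f \<Omega>)"

lemma slice_partial_x_eq:
  "slice_partial_x f I x y = vector_derivative (\<lambda>s. f (slice_point I x y + of_real s)) (at 0)"
proof -
  have "((\<lambda>t. f (slice_point I t y)) has_vector_derivative d) (at x) \<longleftrightarrow>
        ((\<lambda>s. f (slice_point I x y + of_real s)) has_vector_derivative d) (at 0)" for d
  proof -
    have "((\<lambda>t. f (slice_point I t y)) has_vector_derivative d) (at (0 + x)) \<longleftrightarrow>
          ((\<lambda>t. f (slice_point I t y)) \<circ> (\<lambda>s. s + x) has_vector_derivative d) (at 0)"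
      by (simp add: has_vector_derivative_def has_derivative_at o_def add_ac)
    also have "(\<lambda>t. f (slice_point I t y)) \<circ> (\<lambda>s. s + x) =
        (\<lambda>s. f (slice_point I x y + of_real s))"
      by (simp add: o_def slice_point_def algebra_simps)
    finally show ?thesis by simp
  qed
  then show ?thesis by (simp add: slice_partial_x_def vector_derivative_def)
qed

lemma slice_derivative_eq:
  assumes f: "slice_regular_on f \<Omega>" and q: "slice_point I x y \<in> \<Omega>" and I: "I \<in> quat_imag_units"
  shows "slice_derivative f (slice_point I x y) =
           (1/2) *\<^sub>R (slice_partial_x f I x y - I * slice_partial_y f I x y)"
proof -
  let ?D = "\<lambda>J u v. (1/2) *\<^sub>R (slice_partial_x f J u v - J * slice_partial_y f J u v)"
  have D: "?D J u v = slice_partial_x f J u v"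
    if "J \<in> quat_imag_units" "slice_point J u v \<in> \<Omega>" for J u v
  proof -
    from f that have "slice_partial_x f J u v + J * slice_partial_y f J u v = 0"
      by (auto simp: slice_regular_on_def)
    then have "J * slice_partial_y f J u v = - slice_partial_x f J u v"
      by (simp add: add_eq_0_iff)
    then show ?thesis by (simp add: scaleR_2 [symmetric])
  qed
  have same: "?D J u v = ?D I x y"
    if "J \<in> quat_imag_units" "slice_point I x y = slice_point J u v" for J u v
    using D [OF that(1)] D [OF I q] q that(2) by (simp add: slice_partial_x_eq)
  show ?thesis
    unfolding slice_derivative_def
  proof (rule the_equality)
    show "\<forall>J\<in>quat_imag_units. \<forall>u v. slice_point I x y = slice_point J u v \<longrightarrow> ?D I x y = ?D J u v"
      using same by metis
  qed (use I in blast)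
qed

end

theory Submission
  imports Defs "HOL-Complex_Analysis.Riemann_Mapping"
begin

text \<open>
  The statement is one about a single complex variable. Choose a slice through \<open>\<xi>\<close>, that is, an
  imaginary unit \<open>I\<close> and a complex number \<open>\<zeta>\<close> of modulus 1 that becomes \<open>\<xi>\<close> when the imaginary unit
  of \<open>\<complex>\<close> is replaced by \<open>I\<close>. For every quaternion \<open>w\<close>, the coordinates of a quaternion along \<open>w\<close> and
  \<open>I * w\<close> form a complex number that depends complex linearly on it, where \<open>\<complex>\<close> acts by left
  multiplication through the slice (\<open>slice_coord_mult\<close>). Slice regularity says that the
  restriction of \<open>f\<close> to the slice is complex differentiable for this action
  (\<open>slice_regular_has_derivative\<close>), so all these coordinates of \<open>f\<close> are holomorphic, and the
  derivative of a coordinate is the coordinate of the slice derivative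
  (\<open>slice_coord_has_field_derivative\<close>). This does the work of the splitting lemma without the
  choice of a second imaginary unit.

  Let \<open>F\<close> be the coordinate for \<open>w = 1\<close>, the orthogonal projection of \<open>f\<close> to the slice. It maps the
  disc to itself, fixes \<open>0\<close> and \<open>\<zeta>\<close>, and its derivative at \<open>\<zeta>\<close> is no larger than the slice
  derivative of \<open>f\<close> at \<open>\<xi>\<close>. By the boundary Schwarz lemma in the disc (\<open>boundary_Schwarz_lemma\<close>)
  either that derivative exceeds 1 in modulus, and the claim holds, or \<open>F\<close> is the identity. In
  the second case the component of \<open>f z\<close> orthogonal to the slice has squared norm below
  \<open>1 - |z|^2\<close>; it tends to 0 at the boundary, so it vanishes by the maximum modulus principle
  (\<open>eq_id_on_slice_if_coord_eq_id\<close>). Hence \<open>f\<close> is the identity on the real diameter, which lies in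
  every slice, and by analytic continuation in each slice \<open>f\<close> is the identity on the ball
  (\<open>eq_id_on_ball_if_eq_id_on_reals\<close>).
\<close>

section \<open>The boundary Schwarz lemma in the complex disc\<close>

lemma norm_Moebius_identity:
  fixes a b :: complex
  shows "(norm (1 - cnj a * b))\<^sup>2 - (norm (b - a))\<^sup>2 = (1 - (norm a)\<^sup>2) * (1 - (norm b)\<^sup>2)"
  by (cases a, cases b) (simp add: cmod_power2, simp add: power2_eq_square algebra_simps)

text \<open>
  The modulus of a holomorphic self-map of the disc tends to 1 at most as fast as a linear function
  of the distance to the boundary. This is the Schwarz lemma for \<open>g\<close> followed by the Moebius map that sends \<open>g 0\<close>
  to \<open>0\<close>, rewritten by the preceding identity; the constant is crude, but all that matters is that
  it is positive.
\<close>

lemma disc_self_map_radial_decay: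
  assumes holg: "g holomorphic_on ball 0 1"
    and g1: "\<And>z. norm z < 1 \<Longrightarrow> norm (g z) < 1"
    and z: "norm z < 1"
  shows "(1 - norm (g 0)) / (1 + norm (g 0)) * (1 - (norm z)\<^sup>2) \<le> 1 - (norm (g z))\<^sup>2"
proof -
  define a where "a = g 0"
  define k where "k = Moebius_function 0 a \<circ> g"
  have a1: "norm a < 1"
    using g1 [of 0] by (simp add: a_def)
  have "k holomorphic_on ball 0 1"
    unfolding k_def
    by (rule holomorphic_on_compose_gen [OF holg Moebius_function_holomorphic [OF a1]]) (auto simp: g1)
  moreover have "k 0 = 0"
    by (simp add: k_def a_def Moebius_function_eq_zero)
  moreover have "norm (k w) < 1" if "norm w < 1" for w
    using Moebius_function_norm_lt_1 [OF a1 g1 [OF that]] by (simp add: k_def)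
  ultimately have "norm (k z) \<le> norm z"
    using Schwarz_Lemma(1) z by blast
  moreover have ag: "norm a * norm (g z) \<le> norm a"
    using g1 [OF z] by (simp add: mult_left_le)
  have low: "1 - norm a \<le> norm (1 - cnj a * g z)"
    using norm_triangle_ineq2 [of 1 "cnj a * g z"] ag by (simp add: norm_mult)
  ultimately have "norm (g z - a) \<le> norm z * norm (1 - cnj a * g z)"
    using a1 by (auto simp: k_def Moebius_function_simple norm_divide divide_simps split: if_splits)
  then have "(norm (g z - a))\<^sup>2 \<le> (norm z)\<^sup>2 * (norm (1 - cnj a * g z))\<^sup>2"
    by (metis norm_ge_zero power_mono power_mult_distrib)
  then have "(1 - (norm z)\<^sup>2) * (norm (1 - cnj a * g z))\<^sup>2 \<le> (1 - (norm a)\<^sup>2) * (1 - (norm (g z))\<^sup>2)"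
    using norm_Moebius_identity [of a "g z"] by (simp add: algebra_simps)
  moreover have "(1 - (norm z)\<^sup>2) * (1 - norm a)\<^sup>2 \<le> (1 - (norm z)\<^sup>2) * (norm (1 - cnj a * g z))\<^sup>2"
    using z a1 low by (intro mult_left_mono power_mono) (auto simp: power_le_one)
  \<comment> \<open>Writing \<open>1 - (norm a)\<^sup>2\<close> as a product exposes a positive common factor.\<close>
  ultimately have "(1 - norm a) * ((1 - (norm z)\<^sup>2) * (1 - norm a))
      \<le> (1 - norm a) * ((1 + norm a) * (1 - (norm (g z))\<^sup>2))"
    by (simp add: power2_eq_square algebra_simps)
  then have "(1 - (norm z)\<^sup>2) * (1 - norm a) \<le> (1 + norm a) * (1 - (norm (g z))\<^sup>2)"
    using a1 by simp
  moreover have "0 < 1 + norm a"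
    using norm_ge_zero [of a] by linarith
  ultimately show ?thesis
    by (simp add: a_def [symmetric] field_simps)
qed

text \<open>
  Compare \<open>F\<close> with its value at \<open>\<zeta>\<close> along the radius: the difference quotients have modulus at least
  \<open>(1 - |F (r \<zeta>)|) / (1 - r)\<close> and tend to \<open>D\<close> in modulus. The bound is stated with the factor
  \<open>1 + r * c\<close> because that is what \<open>F z = z * g z\<close> yields when \<open>1 - |g z|\<close> is at least \<open>c * (1 - |z|)\<close>.
\<close>

lemma boundary_derivative_ge:
  fixes F :: "complex \<Rightarrow> complex"
  assumes der: "(F has_field_derivative D) (at \<zeta>)"
    and \<zeta>: "norm \<zeta> = 1" "norm (F \<zeta>) = 1"
    and bound: "\<And>r. 0 < r \<Longrightarrow> r < 1 \<Longrightarrow> norm (F (of_real r * \<zeta>)) \<le> 1 - (1 - r) * (1 + r * c)"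
  shows "1 + c \<le> norm D"
proof (rule tendsto_le)
  have "((\<lambda>r. of_real r * \<zeta>) \<longlongrightarrow> of_real 1 * \<zeta>) (at_left 1)"
    by (intro tendsto_intros)
  moreover have "\<forall>\<^sub>F r in at_left 1. of_real r * \<zeta> \<noteq> \<zeta>"
    using \<zeta>(1) by (intro eventually_at_leftI [of 0]) auto
  ultimately have lim: "filterlim (\<lambda>r. of_real r * \<zeta>) (at \<zeta>) (at_left 1)"
    by (simp add: filterlim_at)
  have "((\<lambda>z. (F z - F \<zeta>) / (z - \<zeta>)) \<longlongrightarrow> D) (at \<zeta>)"
    using der by (simp add: has_field_derivative_iff)
  then show "((\<lambda>r. norm ((F (of_real r * \<zeta>) - F \<zeta>) / (of_real r * \<zeta> - \<zeta>))) \<longlongrightarrow> norm D) (at_left 1)"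
    by (intro tendsto_norm filterlim_compose [OF _ lim])
  have "((\<lambda>r. 1 + r * c) \<longlongrightarrow> 1 + 1 * c) (at_left 1)"
    by (intro tendsto_intros)
  then show "((\<lambda>r. 1 + r * c) \<longlongrightarrow> 1 + c) (at_left 1)"
    by simp
  have "1 + r * c \<le> norm ((F (of_real r * \<zeta>) - F \<zeta>) / (of_real r * \<zeta> - \<zeta>))"
    if "r \<in> {0<..<1}" for r
  proof -
    have "of_real r * \<zeta> - \<zeta> = - (of_real (1 - r) * \<zeta>)"
      by (simp add: algebra_simps)
    then have den: "norm (of_real r * \<zeta> - \<zeta>) = 1 - r"
      using that \<zeta> by (simp only: norm_minus_cancel norm_mult norm_of_real) simp
    have "(1 - r) * (1 + r * c) \<le> norm (F \<zeta>) - norm (F (of_real r * \<zeta>))"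
      using bound [of r] that \<zeta> by simp
    also have "\<dots> \<le> norm (F (of_real r * \<zeta>) - F \<zeta>)"
      by (metis norm_minus_commute norm_triangle_ineq2)
    finally show ?thesis
      unfolding norm_divide den using that by (simp add: pos_le_divide_eq mult.commute)
  qed
  then show "\<forall>\<^sub>F r in at_left 1. 1 + r * c \<le> norm ((F (of_real r * \<zeta>) - F \<zeta>) / (of_real r * \<zeta> - \<zeta>))"
    using eventually_at_left_real [of 0 1] by (auto elim: eventually_mono)
qed simp

text \<open>
  If \<open>F\<close> is a rotation, its fixed point \<open>\<zeta>\<close> forces it to be the identity. Otherwise \<open>F z = z * g z\<close>
  where \<open>g\<close> maps the disc into the open disc. The factor \<open>z\<close> alone accounts for a derivative of
  modulus 1 at \<open>\<zeta>\<close>, and the linear decay of \<open>1 - |g|\<close> along the radius adds a positive amount.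
\<close>

theorem boundary_Schwarz_lemma:
  fixes F :: "complex \<Rightarrow> complex"
  assumes holF: "F holomorphic_on ball 0 1" and F0: "F 0 = 0"
    and F1: "\<And>z. norm z < 1 \<Longrightarrow> norm (F z) < 1"
    and \<zeta>: "norm \<zeta> = 1" and der: "(F has_field_derivative D) (at \<zeta>)" and bfix: "F \<zeta> = \<zeta>"
  shows "1 < norm D \<or> (\<forall>z\<in>ball 0 1. F z = z)"
proof (cases "(\<exists>z. norm z < 1 \<and> z \<noteq> 0 \<and> norm (F z) = norm z) \<or> norm (deriv F 0) = 1")
  case True
  then obtain \<alpha> where \<alpha>: "\<And>z. norm z < 1 \<Longrightarrow> F z = \<alpha> * z"
    using Schwarz_Lemma(3) [OF holF F0 F1, of 0] by auto
  have lim: "((\<lambda>r. of_real r * \<zeta>) \<longlongrightarrow> of_real 1 * \<zeta>) (at_left 1)"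
    by (intro tendsto_intros)
  have "isCont F \<zeta>"
    using der by (rule DERIV_isCont)
  then have "((\<lambda>r. F (of_real r * \<zeta>)) \<longlongrightarrow> F \<zeta>) (at_left 1)"
    using isCont_tendsto_compose [OF _ lim, of F] by simp
  moreover have "\<forall>\<^sub>F r in at_left 1. F (of_real r * \<zeta>) = \<alpha> * (of_real r * \<zeta>)"
    using eventually_at_left_real [of 0 1] by (auto elim!: eventually_mono simp: \<alpha> \<zeta> norm_mult)
  ultimately have "((\<lambda>r. \<alpha> * (of_real r * \<zeta>)) \<longlongrightarrow> F \<zeta>) (at_left 1)"
    by (simp add: filterlim_cong)
  moreover have "((\<lambda>r. \<alpha> * (of_real r * \<zeta>)) \<longlongrightarrow> \<alpha> * (of_real 1 * \<zeta>)) (at_left 1)"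
    by (intro tendsto_intros)
  ultimately have "F \<zeta> = \<alpha> * (of_real 1 * \<zeta>)"
    by (rule tendsto_unique [rotated]) simp
  then have "\<alpha> = 1"
    using bfix \<zeta> by auto
  with \<alpha> show ?thesis by simp
next
  case False
  obtain g where holg: "g holomorphic_on ball 0 1"
    and g: "\<And>z. norm z < 1 \<Longrightarrow> F z = z * g z" and g0: "deriv F 0 = g 0"
    by (rule Schwarz3 [OF holF F0]) auto
  have g1: "norm (g z) < 1" if "norm z < 1" for z
  proof (cases "z = 0")
    case True
    then show ?thesis
      using Schwarz_Lemma(2) [OF holF F0 F1 that] False g0 by force
  next
    case nz: False
    then have "norm z * norm (g z) < norm z"
      using Schwarz_Lemma(1) [OF holF F0 F1 that] False that g [OF that]
      by (metis norm_mult order_le_less)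
    then show ?thesis using nz by simp
  qed
  define \<kappa> where "\<kappa> = (1 - norm (g 0)) / (1 + norm (g 0))"
  have \<kappa>: "0 < \<kappa>"
    using g1 [of 0] norm_ge_zero [of "g 0"] by (simp add: \<kappa>_def add_pos_nonneg)
  have "norm (F (of_real r * \<zeta>)) \<le> 1 - (1 - r) * (1 + r * (\<kappa> / 2))" if r: "0 < r" "r < 1" for r
  proof -
    let ?z = "of_real r * \<zeta>"
    have nz: "norm ?z = r"
      using r \<zeta> by (simp add: norm_mult)
    define t where "t = norm (g ?z)"
    have t: "0 \<le> t" "t < 1"
      using g1 [of ?z] nz r by (auto simp: t_def)
    have "\<kappa> * (1 - r\<^sup>2) \<le> 1 - t\<^sup>2"
      using disc_self_map_radial_decay [OF holg g1, of ?z] nz r by (simp add: \<kappa>_def t_def)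
    moreover have "1 - t\<^sup>2 \<le> 2 * (1 - t)"
      using zero_le_power2 [of "1 - t"] by (simp add: power2_eq_square algebra_simps)
    moreover have "\<kappa> * (1 - r) \<le> \<kappa> * (1 - r\<^sup>2)"
      using r \<kappa> by (intro mult_left_mono) (auto simp: power2_eq_square mult_left_le)
    ultimately have "r * (\<kappa> / 2 * (1 - r)) \<le> r * (1 - t)"
      using r by (intro mult_left_mono) auto
    moreover have "norm (F ?z) = r * t"
      using g [of ?z] nz r by (simp add: t_def norm_mult)
    ultimately show ?thesis
      by (simp add: algebra_simps)
  qed
  then have "1 + \<kappa> / 2 \<le> norm D"
    using \<zeta> bfix by (intro boundary_derivative_ge [OF der]) auto
  with \<kappa> show ?thesis by simp
qed

section \<open>Complex coordinates on a slice\<close>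

definition slice_embed :: "quat \<Rightarrow> complex \<Rightarrow> quat" where
  "slice_embed I z = slice_point I (Re z) (Im z)"

text \<open>
  For a unit quaternion \<open>w\<close> these are the coordinates of the orthogonal projection of \<open>q\<close> to the plane
  spanned by \<open>w\<close> and \<open>I * w\<close>, which is a complex line for left multiplication by the slice.
\<close>

definition slice_coord :: "quat \<Rightarrow> quat \<Rightarrow> quat \<Rightarrow> complex" where
  "slice_coord I w q = Complex (q \<bullet> w) (q \<bullet> (I * w))"

lemma quat_of_real_sel [simp]:
  "qRe (of_real r) = r" "qIm1 (of_real r) = 0" "qIm2 (of_real r) = 0" "qIm3 (of_real r) = 0"
  by (simp_all add: of_real_def)

lemma quat_imag_units_iff:
  "I \<in> quat_imag_units \<longleftrightarrow> qRe I = 0 \<and> norm I = 1"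
proof
  assume "I \<in> quat_imag_units"
  then have sq: "I * I = - 1"
    by (simp add: quat_imag_units_def power2_eq_square)
  then have "norm I * norm I = 1"
    by (metis norm_minus_cancel norm_mult norm_one)
  then have n: "norm I = 1"
    by (metis abs_norm_cancel power2_eq_square power2_eq_1_iff real_sqrt_abs real_sqrt_one)
  have "qRe I = 0"
  proof (rule ccontr)
    assume "qRe I \<noteq> 0"
    then have "qIm1 I = 0" "qIm2 I = 0" "qIm3 I = 0"
      using sq by (auto simp: quat_eq_iff)
    moreover have "qRe (I * I) = - 1"
      using sq by simp
    ultimately have "qRe I * qRe I = - 1"
      by simp
    then show False
      by (metis not_one_le_zero neg_0_le_iff_le zero_le_square)
  qed
  with n show "qRe I = 0 \<and> norm I = 1" by simp
next
  assume I: "qRe I = 0 \<and> norm I = 1"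
  then have "(qIm1 I)\<^sup>2 + (qIm2 I)\<^sup>2 + (qIm3 I)\<^sup>2 = 1"
    by (auto simp: norm_quat_def)
  with I show "I \<in> quat_imag_units"
    by (simp add: quat_imag_units_def power2_eq_square quat_eq_iff)
qed

lemma quat_imag_units_square: "I \<in> quat_imag_units \<Longrightarrow> I * I = - 1"
  by (simp add: quat_imag_units_def power2_eq_square)

lemma exists_slice:
  obtains I z where "I \<in> quat_imag_units" "q = slice_embed I z"
proof -
  define v where "v = q - of_real (qRe q)"
  have Re_v: "qRe v = 0"
    by (simp add: v_def)
  show thesis
  proof (cases "v = 0")
    case True
    have "Quat 0 1 0 0 \<in> quat_imag_units"
      by (simp add: quat_imag_units_iff norm_quat_def)
    moreover have "q = slice_embed (Quat 0 1 0 0) (Complex (qRe q) 0)"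
      using True by (simp add: slice_embed_def slice_point_def v_def)
    ultimately show thesis by (rule that)
  next
    case False
    have "v /\<^sub>R norm v \<in> quat_imag_units"
      using False Re_v by (simp add: quat_imag_units_iff)
    moreover have "q = slice_embed (v /\<^sub>R norm v) (Complex (qRe q) (norm v))"
      using False by (simp add: slice_embed_def slice_point_def v_def of_real_def)
    ultimately show thesis by (rule that)
  qed
qed

lemma slice_embed_mult: "slice_embed I z * q = Re z *\<^sub>R q + Im z *\<^sub>R (I * q)"
  by (simp add: slice_embed_def slice_point_def of_real_def distrib_right)

lemma slice_embed_of_real: "slice_embed I (of_real r) = of_real r"
  by (simp add: slice_embed_def slice_point_def)

lemma continuous_slice_embed: "continuous_on A (slice_embed I)"
  unfolding slice_embed_def slice_point_def by (intro continuous_intros)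

lemma norm_slice_embed:
  assumes "I \<in> quat_imag_units"
  shows "norm (slice_embed I z) = norm z"
proof -
  have I: "qRe I = 0" "(qIm1 I)\<^sup>2 + (qIm2 I)\<^sup>2 + (qIm3 I)\<^sup>2 = 1"
    using assms by (auto simp: quat_imag_units_iff norm_quat_def)
  have "(qRe (slice_embed I z))\<^sup>2 + (qIm1 (slice_embed I z))\<^sup>2 + (qIm2 (slice_embed I z))\<^sup>2
      + (qIm3 (slice_embed I z))\<^sup>2
      = (Re z)\<^sup>2 + (Im z)\<^sup>2 * ((qIm1 I)\<^sup>2 + (qIm2 I)\<^sup>2 + (qIm3 I)\<^sup>2)"
    by (simp add: slice_embed_def slice_point_def I(1) power_mult_distrib distrib_left)
  then show ?thesis
    by (simp add: I(2) norm_quat_def cmod_def)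
qed

lemma inner_imag_mult:
  assumes "I \<in> quat_imag_units"
  shows "(I * p) \<bullet> q = - (p \<bullet> (I * q))"
  using assms by (simp add: quat_imag_units_iff inner_quat_def algebra_simps)

lemma inner_imag_mult_both:
  assumes "I \<in> quat_imag_units"
  shows "(I * p) \<bullet> (I * q) = p \<bullet> q"
  by (simp add: inner_imag_mult [OF assms] mult.assoc [symmetric] quat_imag_units_square [OF assms])

text \<open>
  Left multiplication by \<open>I\<close> is skew-adjoint with square \<open>-1\<close>, hence orthogonal. So it exchanges the
  coordinates along \<open>w\<close> and \<open>I * w\<close> up to the sign with which \<open>\<i>\<close> exchanges real and imaginary part.
\<close>

lemma slice_coord_mult:
  assumes "I \<in> quat_imag_units"
  shows "slice_coord I w (slice_embed I z * q) = z * slice_coord I w q"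
  by (simp add: slice_coord_def slice_embed_mult inner_add_left inner_imag_mult_both [OF assms]
      inner_imag_mult [OF assms, of _ w] complex_eq_iff)

lemma slice_coord_slice_embed:
  assumes "I \<in> quat_imag_units"
  shows "slice_coord I w (slice_embed I z) = z * slice_coord I w 1"
  using slice_coord_mult [OF assms, of w z 1] by simp

lemma slice_coord_one_one:
  assumes "I \<in> quat_imag_units"
  shows "slice_coord I 1 1 = 1"
  using assms by (simp add: slice_coord_def quat_imag_units_iff inner_quat_def complex_eq_iff)

lemma bounded_linear_slice_coord: "bounded_linear (slice_coord I w)"
proof -
  have "bounded_linear (\<lambda>q. of_real (q \<bullet> w) + \<i> * of_real (q \<bullet> (I * w)))"
    by (intro bounded_linear_intros bounded_linear_add bounded_linear_const_mult
        bounded_linear_compose [OF bounded_linear_of_real])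
  then show ?thesis
    by (simp only: slice_coord_def [abs_def] Complex_eq)
qed

text \<open>
  Since \<open>1\<close> and \<open>I\<close> are orthonormal, the coordinate for \<open>w = 1\<close> is the orthogonal projection to the
  slice itself.
\<close>

lemma slice_coord_pythagoras:
  assumes I: "I \<in> quat_imag_units"
  shows "(norm (q - slice_embed I (slice_coord I 1 q)))\<^sup>2 = (norm q)\<^sup>2 - (norm (slice_coord I 1 q))\<^sup>2"
proof -
  define z where "z = slice_coord I 1 q"
  have zz: "z = Complex (q \<bullet> 1) (q \<bullet> I)"
    by (simp add: z_def slice_coord_def)
  have "q \<bullet> slice_embed I z = q \<bullet> (slice_embed I z * 1)"
    by simp
  also have "\<dots> = (Re z)\<^sup>2 + (Im z)\<^sup>2"
    by (simp only: slice_embed_mult inner_add_right inner_scaleR_right) (simp add: zz power2_eq_square)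
  finally have "q \<bullet> slice_embed I z = (norm z)\<^sup>2"
    by (simp add: cmod_power2)
  moreover have "slice_embed I z \<bullet> slice_embed I z = (norm z)\<^sup>2"
    by (simp add: norm_slice_embed [OF I] flip: power2_norm_eq_inner)
  ultimately show ?thesis
    unfolding z_def [symmetric] power2_norm_eq_inner [of "q - _"] power2_norm_eq_inner [of q]
    by (simp add: inner_diff_left inner_diff_right inner_commute)
qed

lemma norm_slice_coord_one_le:
  assumes "I \<in> quat_imag_units"
  shows "norm (slice_coord I 1 q) \<le> norm q"
  using slice_coord_pythagoras [OF assms, of q]
  by (metis diff_ge_0_iff_ge norm_ge_zero power2_le_imp_le zero_le_power2)

lemma quat_eq_if_slice_coords_eq:
  assumes "\<And>w. slice_coord I w p = slice_coord I w q"
  shows "p = q"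
  using assms by (metis complex.inject slice_coord_def vector_eq_rdot)

section \<open>Slice regular functions in complex coordinates\<close>

text \<open>
  Continuity of one partial derivative near \<open>z\<close> and existence of the other make the restriction to the
  slice totally differentiable. The Cauchy-Riemann equation makes the partial derivative in \<open>y\<close>
  equal to \<open>I\<close> times the one in \<open>x\<close>, and the slice derivative equal to the latter, so that the total
  derivative is left multiplication of the slice derivative by complex increments.
\<close>

lemma slice_regular_has_derivative:
  assumes f: "slice_regular_on f \<Omega>" and I: "I \<in> quat_imag_units" and z: "slice_embed I z \<in> \<Omega>"
  shows "((\<lambda>z. f (slice_embed I z)) has_derivative
      (\<lambda>h. slice_embed I h * slice_derivative f (slice_embed I z))) (at z)"
proof -
  define S where "S = {(x, y). slice_point I x y \<in> \<Omega>}"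
  define x y where "x = Re z" and "y = Im z"
  let ?fx = "slice_partial_x f I" and ?fy = "slice_partial_y f I"
  have xy: "(x, y) \<in> S"
    using z by (simp add: S_def x_def y_def slice_embed_def)
  have "open \<Omega>" and C1: "slice_C1_on f I \<Omega>"
    and CR: "?fx x y + I * ?fy x y = 0"
    using f I xy by (auto simp: slice_regular_on_def is_domain_of_def S_def)
  have "open ((\<lambda>p. slice_point I (fst p) (snd p)) -` \<Omega>)"
    using \<open>open \<Omega>\<close> by (rule open_vimage) (auto simp: slice_point_def intro!: continuous_intros)
  also have "(\<lambda>p. slice_point I (fst p) (snd p)) -` \<Omega> = S"
    by (auto simp: S_def)
  finally have "open S" .
  \<comment> \<open>The criterion for total differentiability wants a product with a convex second factor.\<close>
  then obtain A B where AB: "open A" "open B" "(x, y) \<in> A \<times> B" "A \<times> B \<subseteq> S"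
    using xy by (rule open_prod_elim)
  then obtain e where e: "e > 0" "ball y e \<subseteq> B"
    by (auto elim: openE)
  have box: "A \<times> ball y e \<subseteq> S" "(x, y) \<in> A \<times> ball y e" "open (A \<times> ball y e)"
    using AB e by (auto intro: open_Times)
  have "((\<lambda>(x, y). f (slice_point I x y)) has_derivative
      (\<lambda>(s, t). s *\<^sub>R ?fx x y + blinfun_scaleR_left (?fy x y) t)) (at (x, y) within A \<times> ball y e)"
  proof (rule has_derivative_partialsI)
    show "((\<lambda>x. f (slice_point I x y)) has_derivative (\<lambda>s. s *\<^sub>R ?fx x y)) (at x within A)"
      using C1 xy
      by (auto simp: slice_C1_on_def S_def slice_partial_x_def vector_derivative_works
          has_vector_derivative_def intro: has_derivative_at_withinI)
    show "((\<lambda>v. f (slice_point I u v)) has_derivative blinfun_scaleR_left (?fy u v)) (at v within ball y e)"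
      if "u \<in> A" "v \<in> ball y e" for u v
    proof -
      have "(u, v) \<in> S"
        using that box by auto
      then have "((\<lambda>v. f (slice_point I u v)) has_derivative (\<lambda>t. t *\<^sub>R ?fy u v)) (at v)"
        using C1
        by (auto simp: slice_C1_on_def S_def slice_partial_y_def vector_derivative_works
            has_vector_derivative_def)
      moreover have "blinfun_apply (blinfun_scaleR_left (?fy u v)) = (\<lambda>t. t *\<^sub>R ?fy u v)"
        by auto
      ultimately show ?thesis
        by (simp add: has_derivative_at_withinI)
    qed
    have "continuous_on S (\<lambda>(x, y). ?fy x y)"
      using C1 by (simp add: slice_C1_on_def S_def)
    then have "isCont (\<lambda>(x, y). ?fy x y) (x, y)"
      using \<open>open S\<close> xy by (simp add: continuous_on_eq_continuous_at)
    then have "isCont (\<lambda>p. blinfun_scaleR_left (case p of (x, y) \<Rightarrow> ?fy x y)) (x, y)"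
      by (rule bounded_linear.isCont [OF bounded_linear_blinfun_scaleR_left])
    then show "continuous (at (x, y) within A \<times> ball y e) (\<lambda>(x, y). blinfun_scaleR_left (?fy x y))"
      by (auto simp: case_prod_unfold intro: continuous_at_imp_continuous_at_within)
  qed (use e in auto)
  then have "((\<lambda>(x, y). f (slice_point I x y)) has_derivative
      (\<lambda>(s, t). s *\<^sub>R ?fx x y + t *\<^sub>R ?fy x y)) (at (x, y))"
    by (simp add: at_within_open [OF box(2,3)])
  moreover have "((\<lambda>z. (Re z, Im z)) has_derivative (\<lambda>h. (Re h, Im h))) (at z)"
    by (intro derivative_intros)
  ultimately have "((\<lambda>z. f (slice_embed I z)) has_derivative
      (\<lambda>h. Re h *\<^sub>R ?fx x y + Im h *\<^sub>R ?fy x y)) (at z)"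
    using has_derivative_compose [of "\<lambda>z. (Re z, Im z)" "\<lambda>h. (Re h, Im h)" z UNIV
        "\<lambda>(x, y). f (slice_point I x y)" "\<lambda>(s, t). s *\<^sub>R ?fx x y + t *\<^sub>R ?fy x y"]
    by (simp add: x_def y_def slice_embed_def)
  moreover have "Re h *\<^sub>R ?fx x y + Im h *\<^sub>R ?fy x y = slice_embed I h * slice_derivative f (slice_embed I z)" for h
  proof -
    have fx: "?fx x y = - (I * ?fy x y)"
      using CR by (simp add: add_eq_0_iff2)
    have "slice_derivative f (slice_embed I z) = (1/2) *\<^sub>R (?fx x y - I * ?fy x y)"
      using slice_derivative_eq [OF f _ I, of x y] xy by (simp add: S_def slice_embed_def x_def y_def)
    also have "\<dots> = - (I * ?fy x y)"
    proof -
      have "(1/2) *\<^sub>R (- a - a) = - a" for a :: quat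
        by (simp add: quat_eq_iff)
      then show ?thesis
        unfolding fx .
    qed
    finally have d: "slice_derivative f (slice_embed I z) = - (I * ?fy x y)" .
    have "I * - (I * ?fy x y) = ?fy x y"
      by (simp add: mult.assoc [symmetric] quat_imag_units_square [OF I])
    then show ?thesis
      unfolding slice_embed_mult d fx by simp
  qed
  ultimately show ?thesis
    by simp
qed

lemma slice_coord_has_field_derivative:
  assumes f: "slice_regular_on f \<Omega>" and I: "I \<in> quat_imag_units" and z: "slice_embed I z \<in> \<Omega>"
  shows "((\<lambda>z. slice_coord I w (f (slice_embed I z))) has_field_derivative
      slice_coord I w (slice_derivative f (slice_embed I z))) (at z)"
proof -
  let ?d = "slice_coord I w (slice_derivative f (slice_embed I z))"
  have "((\<lambda>z. slice_coord I w (f (slice_embed I z))) has_derivative (\<lambda>h. h * ?d)) (at z)"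
    using bounded_linear.has_derivative [OF bounded_linear_slice_coord slice_regular_has_derivative [OF assms], of I w]
    by (simp add: slice_coord_mult [OF I])
  also have "(\<lambda>h. h * ?d) = (*) ?d"
    by (rule ext) (rule mult.commute)
  finally show ?thesis
    by (simp add: has_field_derivative_def)
qed

lemma slice_coord_holomorphic:
  assumes f: "slice_regular_on f \<Omega>" and ball: "ball 0 1 \<subseteq> \<Omega>" and I: "I \<in> quat_imag_units"
  shows "(\<lambda>z. slice_coord I w (f (slice_embed I z))) holomorphic_on ball 0 1"
proof (rule holomorphic_onI)
  fix z :: complex assume "z \<in> ball 0 1"
  then have "slice_embed I z \<in> \<Omega>"
    using ball norm_slice_embed [OF I, of z] by (auto simp: subset_iff)
  then show "(\<lambda>z. slice_coord I w (f (slice_embed I z))) field_differentiable at z within ball 0 1"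
    using slice_coord_has_field_derivative [OF f I] field_differentiable_def
      field_differentiable_at_within by blast
qed

text \<open>
  Every slice contains the real diameter of the ball, and \<open>0\<close> is a limit point of it. So knowledge on
  the diameter propagates to each slice by analytic continuation of the coordinates.
\<close>

lemma eq_id_on_ball_if_eq_id_on_reals:
  assumes f: "slice_regular_on f \<Omega>" and ball: "ball 0 1 \<subseteq> \<Omega>"
    and real: "\<And>r :: real. \<bar>r\<bar> < 1 \<Longrightarrow> f (of_real r) = of_real r"
    and q: "q \<in> ball 0 1"
  shows "f q = q"
proof -
  obtain K z where K: "K \<in> quat_imag_units" and qz: "q = slice_embed K z"
    by (rule exists_slice)
  have z: "norm z < 1"
    using q norm_slice_embed [OF K, of z] qz by simp
  show ?thesis
    unfolding qz
  proof (rule quat_eq_if_slice_coords_eq)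
    fix w
    let ?h = "\<lambda>z. slice_coord K w (f (slice_embed K z)) - slice_coord K w (slice_embed K z)"
    have "?h z = 0"
    proof (rule analytic_continuation [where f = ?h])
      show "?h holomorphic_on ball 0 1"
        unfolding slice_coord_slice_embed [OF K]
        by (intro holomorphic_intros slice_coord_holomorphic [OF f ball K])
      show "of_real ` {-1<..<1::real} \<subseteq> ball (0 :: complex) 1"
        by auto
      have "(0::real) islimpt {-1<..<1}"
        by (rule interior_limit_point) (simp add: interior_open)
      then have "(of_real 0 :: complex) islimpt of_real ` {-1<..<1::real}"
        by (rule islimpt_isCont_image) (auto simp: eventually_at_filter)
      then show "(0 :: complex) islimpt of_real ` {-1<..<1::real}"
        by simp
    qed (use z real in \<open>auto simp: slice_embed_of_real\<close>)
    then show "slice_coord K w (f (slice_embed K z)) = slice_coord K w (slice_embed K z)"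
      by simp
  qed
qed

text \<open>
  If the projection of \<open>f\<close> to the slice is already the identity, the orthogonal remainder has
  squared norm at most \<open>1 - |z|^2\<close> because \<open>f\<close> stays in the ball. The coordinates of
  \<open>f z - z\<close> are holomorphic and bounded by a multiple of \<open>sqrt (1 - |z|^2)\<close>; the maximum modulus
  principle on discs of radius tending to 1 makes them vanish.
\<close>

lemma eq_id_on_slice_if_coord_eq_id:
  assumes f: "slice_regular_on f \<Omega>" and ball: "ball 0 1 \<subseteq> \<Omega>" and I: "I \<in> quat_imag_units"
    and self: "f ` ball 0 1 \<subseteq> ball 0 1"
    and id: "\<And>z. norm z < 1 \<Longrightarrow> slice_coord I 1 (f (slice_embed I z)) = z"
    and z: "norm z < 1"
  shows "f (slice_embed I z) = slice_embed I z"
proof (rule quat_eq_if_slice_coords_eq)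
  fix w
  let ?h = "\<lambda>z. slice_coord I w (f (slice_embed I z)) - slice_coord I w (slice_embed I z)"
  have hol: "?h holomorphic_on ball 0 1"
    unfolding slice_coord_slice_embed [OF I]
    by (intro holomorphic_intros slice_coord_holomorphic [OF f ball I])
  interpret sc: bounded_linear "slice_coord I w"
    by (rule bounded_linear_slice_coord)
  \<comment> \<open>The value of \<open>C\<close> is irrelevant, as it gets multiplied by a quantity that tends to 0.\<close>
  obtain C where C: "0 < C" "\<And>q. norm (slice_coord I w q) \<le> norm q * C"
    using sc.pos_bounded by blast
  have bound: "norm (?h u) \<le> C * sqrt (1 - (norm u)\<^sup>2)" if u: "norm u < 1" for u
  proof -
    have "norm (f (slice_embed I u)) < 1"
      using self u norm_slice_embed [OF I, of u] by (auto simp: subset_iff)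
    then have "(norm (f (slice_embed I u)))\<^sup>2 \<le> 1"
      by (simp add: power_le_one)
    then have "(norm (f (slice_embed I u) - slice_embed I u))\<^sup>2 \<le> 1 - (norm u)\<^sup>2"
      using slice_coord_pythagoras [OF I, of "f (slice_embed I u)"] by (simp add: id [OF u])
    then have "norm (f (slice_embed I u) - slice_embed I u) \<le> sqrt (1 - (norm u)\<^sup>2)"
      by (rule real_le_rsqrt)
    then show ?thesis
      using C(2) [of "f (slice_embed I u) - slice_embed I u"] C(1)
      by (simp add: sc.diff [symmetric] mult.commute) (meson mult_left_mono less_imp_le order_trans)
  qed
  have le: "norm (?h z) \<le> C * sqrt (1 - r\<^sup>2)" if r: "norm z < r" "r < 1" for r
  proof (rule maximum_modulus_frontier [of ?h "ball 0 r"])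
    have r0: "0 < r"
      using r norm_ge_zero [of z] by linarith
    show "?h holomorphic_on interior (ball 0 r)"
      using r by (auto intro: holomorphic_on_subset [OF hol])
    show "continuous_on (closure (ball 0 r)) ?h"
      using r r0 by (auto intro!: continuous_on_subset [OF holomorphic_on_imp_continuous_on [OF hol]])
    show "norm (?h u) \<le> C * sqrt (1 - r\<^sup>2)" if "u \<in> frontier (ball 0 r)" for u
      using bound [of u] that r r0 by simp
  qed (use r in auto)
  have "norm (?h z) \<le> C * sqrt (1 - 1\<^sup>2)"
  proof (rule tendsto_lowerbound)
    show "((\<lambda>r. C * sqrt (1 - r\<^sup>2)) \<longlongrightarrow> C * sqrt (1 - 1\<^sup>2)) (at_left 1)"
      by (intro tendsto_intros)
    show "\<forall>\<^sub>F r in at_left 1. norm (?h z) \<le> C * sqrt (1 - r\<^sup>2)"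
      using eventually_at_left_real [OF z] by (auto elim!: eventually_mono intro: le)
  qed simp
  then show "slice_coord I w (f (slice_embed I z)) = slice_coord I w (slice_embed I z)"
    by simp
qed

section \<open>The boundary Schwarz lemma for slice regular functions\<close>

theorem theorem5:
  fixes f :: "quat \<Rightarrow> quat" and \<xi> :: quat
  assumes "\<xi> \<in> frontier (ball 0 1)"
    and "slice_regular_on_ball_and \<xi> f"
    and "f ` ball 0 1 \<subseteq> ball 0 1"
    and "f 0 = 0"
    and "f \<xi> = \<xi>"
    and "\<not> (\<forall>q\<in>ball 0 1. f q = q)"
  shows "norm (slice_derivative f \<xi>) > 1"
proof -
  obtain \<Omega> where ball: "ball 0 1 \<subseteq> \<Omega>" and \<xi>: "\<xi> \<in> \<Omega>" and f: "slice_regular_on f \<Omega>"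
    using assms(2) by (auto simp: slice_regular_on_ball_and_def)
  obtain I \<zeta> where I: "I \<in> quat_imag_units" and \<xi>\<zeta>: "\<xi> = slice_embed I \<zeta>"
    by (rule exists_slice)
  let ?F = "\<lambda>z. slice_coord I 1 (f (slice_embed I z))"
  have coord: "slice_coord I 1 (slice_embed I z) = z" for z
    by (simp add: slice_coord_slice_embed [OF I] slice_coord_one_one [OF I])
  have "1 < norm (slice_coord I 1 (slice_derivative f \<xi>)) \<or> (\<forall>z\<in>ball 0 1. ?F z = z)"
  proof (rule boundary_Schwarz_lemma)
    show "?F holomorphic_on ball 0 1"
      by (rule slice_coord_holomorphic [OF f ball I])
    show "?F 0 = 0"
      using coord [of 0] slice_embed_of_real [of I 0] assms(4) by simp
    show "norm (?F z) < 1" if "norm z < 1" for z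
    proof -
      have "norm (f (slice_embed I z)) < 1"
        using assms(3) that norm_slice_embed [OF I, of z] by (auto simp: subset_iff)
      then show ?thesis
        using norm_slice_coord_one_le [OF I] order_le_less_trans by blast
    qed
    show "norm \<zeta> = 1"
      using assms(1) norm_slice_embed [OF I, of \<zeta>] by (simp add: \<xi>\<zeta>)
    show "(?F has_field_derivative slice_coord I 1 (slice_derivative f \<xi>)) (at \<zeta>)"
      unfolding \<xi>\<zeta> using \<xi> \<xi>\<zeta> by (intro slice_coord_has_field_derivative [OF f I]) simp
    show "?F \<zeta> = \<zeta>"
      using assms(5) coord by (simp add: \<xi>\<zeta>)
  qed
  then show ?thesis
  proof
    assume "1 < norm (slice_coord I 1 (slice_derivative f \<xi>))"
    then show ?thesis
      using norm_slice_coord_one_le [OF I] order_less_le_trans by blast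
  next
    assume id: "\<forall>z\<in>ball 0 1. ?F z = z"
    have "f (of_real r) = of_real r" if "\<bar>r\<bar> < 1" for r
      using eq_id_on_slice_if_coord_eq_id [OF f ball I assms(3), of "of_real r"] id that
      by (simp add: slice_embed_of_real)
    then have "\<forall>q\<in>ball 0 1. f q = q"
      using eq_id_on_ball_if_eq_id_on_reals [OF f ball] by blast
    with assms(6) show ?thesis by contradiction
  qed
qed

end
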